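(* Let $m$ be a positive integer and let $A$ be an $m\times m$ matrix over the complex zeon algebra $\mathbb{C}\mathfrak{Z}$ that is self-adjoint (i.e. $A^\dagger=A$) and has $m$ (pairwise distinct) spectrally simple eigenvalues $\lambda_1,\ldots,\lambda_m\in\mathbb{C}\mathfrak{Z}$. Let $v_1,\ldots,v_m\in\mathbb{C}\mathfrak{Z}^m$ be normalized zeon eigenvectors of $A$ associated with $\lambda_1,\ldots,\lambda_m$, respectively, and set $\pi_j=v_jv_j^\dagger$ for $j=1,\ldots,m$. Then $$A=\bigoplus_{j=1}^m\lambda_j\pi_j.$$
   Context: The complex zeon algebra $\mathbb{C}\mathfrak{Z}$ is the commutative unital $\mathbb{C}$-algebra generated by $\{\zeta_{\{i\}}:i\in\mathbb{N}\}$ subject to $\zeta_{\{i\}}^2=0$ for all $i$. Its elements are finite $\mathbb{C}$-linear combinations $u=\sum_I u_I\zeta_I$ of the basis blades $\zeta_I=\prod_{i\in I}\zeta_{\{i\}}$, where $I$ ranges over finite subsets of $\mathbb{N}$ and $\zeta_\varnothing=1$. The scalar part of $u$ is $\mathfrak{C}u=u_\varnothing\in\mathbb{C}$, and $\mathbb{C}\mathfrak{Z}^\circ=\{u:\mathfrak{C}u=0\}$ is the ideal of nilpotent elements. Complex conjugation is $\overline{u}=\sum_I\overline{u_I}\zeta_I$; for a matrix or column vector $M$ over $\mathbb{C}\mathfrak{Z}$, $M^\dagger=\overline{M}^{\intercal}$ is the conjugate transpose. On $\mathbb{C}\mathfrak{Z}^m$ (column vectors) define $\langle x,y\rangle=y^\dagger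 x\in\mathbb{C}\mathfrak{Z}$. A vector $v$ is null if $\mathfrak{C}\langle v,v\rangle=0$ (equivalently $v\in(\mathbb{C}\mathfrak{Z}^\circ)^m$); a non-null vector $v$ is normalized if $\langle v,v\rangle=1$. For a polynomial $\varphi(u)=\sum_\ell\alpha_\ell u^\ell$ over $\mathbb{C}\mathfrak{Z}$, the induced complex polynomial is $f_\varphi(z)=\sum_\ell(\mathfrak{C}\alpha_\ell)z^\ell$. A zero $\lambda\in\mathbb{C}\mathfrak{Z}$ of $\varphi$ is spectrally simple if $\mathfrak{C}\lambda$ is a simple zero of $f_\varphi$. The characteristic polynomial of $A$ is $\chi_A(t)=\det(t\mathbb{I}-A)$. The zeon eigenvalues (spectrally simple eigenvalues) of $A$ are the spectrally simple zeros of $\chi_A$ in $\mathbb{C}\mathfrak{Z}$. A zeon eigenvector associated with a zeon eigenvalue $\lambda$ is a non-null $\xi\in\mathbb{C}\mathfrak{Z}^m$ with $A\xi=\lambda\xi$. The symbol $\bigoplus$ denotes the ordinary sum of the $m\times m$ matrices $\lambda_j\pi_j$ (written as a direct sum because the $\pi_j$ act as mutually orthogonal projections). *)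

theory Defs
  imports "Jordan_Normal_Form.Char_Poly" "Jordan_Normal_Form.Conjugate"
begin

section \<open>The complex zeon algebra\<close>

text \<open>
  A zeon is represented by its finitely supported coefficient function \<open>I \<mapsto> u\<^sub>I\<close>, where \<open>I\<close>
  ranges over the finite subsets of \<open>\<nat>\<close>.  Coefficients at infinite index sets are forced to be \<open>0\<close>.
\<close>

typedef zeon = "{u :: nat set \<Rightarrow> complex. finite {I. u I \<noteq> 0} \<and> (\<forall>I. u I \<noteq> 0 \<longrightarrow> finite I)}"
  morphisms blade_coeff Abs_zeon
  by (rule exI[of _ "\<lambda>_. 0"]) auto

setup_lifting type_definition_zeon

lemma blade_coeff_infinite: "infinite I \<Longrightarrow> blade_coeff u I = 0"
  using blade_coeff[of u] by blast

lemma zeon_eqI: "(\<And>I. finite I \<Longrightarrow> blade_coeff u I = blade_coeff v I) \<Longrightarrow> u = v"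
proof (rule blade_coeff_inject[THEN iffD1], rule ext)
  fix I
  assume "\<And>I. finite I \<Longrightarrow> blade_coeff u I = blade_coeff v I"
  then show "blade_coeff u I = blade_coeff v I"
    by (cases "finite I") (simp_all add: blade_coeff_infinite)
qed

lemma finite_support: "finite {I. blade_coeff u I \<noteq> 0}"
  using blade_coeff[of u] by auto

text \<open>
  The product is determined by \<open>\<zeta>\<^sub>J \<zeta>\<^sub>K = \<zeta>\<^bsub>J \<union> K\<^esub>\<close> if \<open>J \<inter> K = {}\<close> and
  \<open>\<zeta>\<^sub>J \<zeta>\<^sub>K = 0\<close> otherwise, so the coefficient of \<open>\<zeta>\<^sub>I\<close> in \<open>u v\<close> is the sum of \<open>u\<^sub>J v\<^sub>K\<close> over
  the partitions of \<open>I\<close> into two disjoint parts \<open>J\<close> and \<open>K\<close>.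
\<close>

instantiation zeon :: comm_ring_1
begin

lift_definition zero_zeon :: zeon is "\<lambda>_. 0" by auto

lift_definition one_zeon :: zeon is "\<lambda>I. if I = {} then 1 else 0" by auto

lift_definition plus_zeon :: "zeon \<Rightarrow> zeon \<Rightarrow> zeon" is "\<lambda>u v I. u I + v I"
proof -
  fix u v :: "nat set \<Rightarrow> complex"
  assume a: "finite {I. u I \<noteq> 0} \<and> (\<forall>I. u I \<noteq> 0 \<longrightarrow> finite I)"
    "finite {I. v I \<noteq> 0} \<and> (\<forall>I. v I \<noteq> 0 \<longrightarrow> finite I)"
  have "{I. u I + v I \<noteq> 0} \<subseteq> {I. u I \<noteq> 0} \<union> {I. v I \<noteq> 0}" by auto
  moreover have "finite ({I. u I \<noteq> 0} \<union> {I. v I \<noteq> 0})" using a by simp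
  ultimately have "finite {I. u I + v I \<noteq> 0}" by (rule finite_subset)
  moreover have "\<forall>I. u I + v I \<noteq> 0 \<longrightarrow> finite I" using a by (metis add.right_neutral)
  ultimately show "finite {I. u I + v I \<noteq> 0} \<and> (\<forall>I. u I + v I \<noteq> 0 \<longrightarrow> finite I)" by blast
qed

lift_definition uminus_zeon :: "zeon \<Rightarrow> zeon" is "\<lambda>u I. - u I" by auto

definition minus_zeon :: "zeon \<Rightarrow> zeon \<Rightarrow> zeon" where "minus_zeon u v = u + (- v)"

lift_definition times_zeon :: "zeon \<Rightarrow> zeon \<Rightarrow> zeon" is
  "\<lambda>u v I. \<Sum>J\<in>Pow I. u J * v (I - J)"
proof -
  fix u v :: "nat set \<Rightarrow> complex"
  assume a: "finite {I. u I \<noteq> 0} \<and> (\<forall>I. u I \<noteq> 0 \<longrightarrow> finite I)"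
    "finite {I. v I \<noteq> 0} \<and> (\<forall>I. v I \<noteq> 0 \<longrightarrow> finite I)"
  let ?S = "{I. (\<Sum>J\<in>Pow I. u J * v (I - J)) \<noteq> 0}"
  let ?T = "(\<lambda>(J, K). J \<union> K) ` ({I. u I \<noteq> 0} \<times> {I. v I \<noteq> 0})"
  have S: "I \<in> ?T" if "I \<in> ?S" for I
  proof -
    from that obtain J where "J \<in> Pow I" "u J * v (I - J) \<noteq> 0"
      by (metis (mono_tags, lifting) mem_Collect_eq sum.not_neutral_contains_not_neutral)
    then have "J \<union> (I - J) = I" "u J \<noteq> 0" "v (I - J) \<noteq> 0" by auto
    then show ?thesis by (intro image_eqI[of _ _ "(J, I - J)"]) simp_all
  qed
  have "finite ({I. u I \<noteq> 0} \<times> {I. v I \<noteq> 0})" using a by (intro finite_cartesian_product) blast+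
  then have "finite ?T" by (rule finite_imageI)
  then have fin: "finite ?S" using S by (meson finite_subset subsetI)
  have fin': "finite I" if "I \<in> ?T" for I
  proof -
    from that obtain J K where I: "I = J \<union> K" and JK: "u J \<noteq> 0" "v K \<noteq> 0"
      by (elim imageE) (simp split: prod.splits)
    from a JK have "finite J" "finite K" by blast+
    then show ?thesis unfolding I by (rule finite_UnI)
  qed
  show "finite ?S \<and> (\<forall>I. (\<Sum>J\<in>Pow I. u J * v (I - J)) \<noteq> 0 \<longrightarrow> finite I)"
    by (intro conjI allI impI fin) (rule fin', rule S, rule CollectI)
qed

instance
proof
  fix u v w :: zeon
  show "u + v + w = u + (v + w)" "u + v = v + u" "0 + u = u" "- u + u = 0"
    by (transfer; simp add: fun_eq_iff ac_simps)+
  show "u - v = u + - v" by (rule minus_zeon_def)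
  show "(0::zeon) \<noteq> 1" by transfer (auto simp: fun_eq_iff)
  show "(u + v) * w = u * w + v * w"
    by transfer (simp add: fun_eq_iff distrib_right sum.distrib)
  show "u * v = v * u"
  proof (rule zeon_eqI)
    fix I :: "nat set"
    have "(\<Sum>J\<in>Pow I. blade_coeff u J * blade_coeff v (I - J)) =
        (\<Sum>J\<in>Pow I. blade_coeff v J * blade_coeff u (I - J))"
      by (rule sum.reindex_bij_witness[of _ "\<lambda>J. I - J" "\<lambda>J. I - J"])
        (auto simp: double_diff)
    then show "blade_coeff (u * v) I = blade_coeff (v * u) I" by (simp add: times_zeon.rep_eq)
  qed
  show "1 * u = u"
  proof (rule zeon_eqI)
    fix I :: "nat set" assume I: "finite I"
    have "(\<Sum>J\<in>Pow I. (if J = {} then 1 else 0) * blade_coeff u (I - J)) =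
        (\<Sum>J\<in>Pow I. if J = {} then blade_coeff u I else 0)"
      by (rule sum.cong) auto
    then show "blade_coeff (1 * u) I = blade_coeff u I"
      using I by (simp add: times_zeon.rep_eq one_zeon.rep_eq)
  qed
  show "u * v * w = u * (v * w)"
  proof (rule zeon_eqI)
    fix I :: "nat set" assume I: "finite I"
    let ?u = "blade_coeff u" and ?v = "blade_coeff v" and ?w = "blade_coeff w"
    have fin: "finite J" if "J \<in> Pow I" for J using that I finite_subset by auto
    have "(\<Sum>J\<in>Pow I. (\<Sum>K\<in>Pow J. ?u K * ?v (J - K)) * ?w (I - J)) =
        (\<Sum>(J, K)\<in>Sigma (Pow I) Pow. ?u K * ?v (J - K) * ?w (I - J))"
      using I fin by (subst sum.Sigma[symmetric]) (auto simp: sum_distrib_right)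
    also have "\<dots> = (\<Sum>(K, L)\<in>Sigma (Pow I) (\<lambda>K. Pow (I - K)). ?u K * (?v L * ?w (I - K - L)))"
    proof (rule sum.reindex_bij_witness[of _ "\<lambda>(K, L). (K \<union> L, K)" "\<lambda>(J, K). (K, J - K)"])
      fix a assume a: "a \<in> Sigma (Pow I) Pow"
      obtain J K where [simp]: "a = (J, K)" by (cases a)
      have "I - K - (J - K) = I - J" using a by auto
      then show "(case case a of (J, K) \<Rightarrow> (K, J - K) of
          (K, L) \<Rightarrow> ?u K * (?v L * ?w (I - K - L))) =
          (case a of (J, K) \<Rightarrow> ?u K * ?v (J - K) * ?w (I - J))"
        by (simp add: mult.assoc)
    qed auto
    also have "\<dots> = (\<Sum>K\<in>Pow I. ?u K * (\<Sum>L\<in>Pow (I - K). ?v L * ?w (I - K - L)))"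
      using I by (subst sum.Sigma[symmetric]) (auto simp: sum_distrib_left)
    finally show "blade_coeff (u * v * w) I = blade_coeff (u * (v * w)) I"
      by (simp add: times_zeon.rep_eq)
  qed
qed

end

lift_definition zeon_const :: "complex \<Rightarrow> zeon" is "\<lambda>c I. if I = {} then c else 0" by auto

lift_definition zeon_gen :: "nat \<Rightarrow> zeon" is "\<lambda>i I. if I = {i} then 1 else 0" by auto

definition scalar_part :: "zeon \<Rightarrow> complex" where
  "scalar_part u = blade_coeff u {}"

instantiation zeon :: conjugatable_ring
begin

lift_definition conjugate_zeon :: "zeon \<Rightarrow> zeon" is "\<lambda>u I. cnj (u I)" by auto

instance
proof
  fix u v :: zeon
  show "conjugate (conjugate u) = u" by transfer simp
  show "(conjugate u = conjugate v) = (u = v)" by transfer (simp add: fun_eq_iff)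
  show "conjugate (u * v) = conjugate u * conjugate v" by transfer (simp add: fun_eq_iff)
  show "conjugate (u + v) = conjugate u + conjugate v" by transfer simp
  show "conjugate (- u) = - conjugate u" by transfer simp
  show "conjugate (0 :: zeon) = 0" by transfer simp
qed

end

text \<open>
  The next facts confirm that this is the intended algebra: scalars embed as a subring, the generators
  square to zero, and the blades \<open>\<zeta>\<^sub>I = \<Prod>i\<in>I. \<zeta>\<^sub>i\<close> form a basis with coordinates \<^const>\<open>blade_coeff\<close>.
\<close>

lemma blade_coeff_const_mult: "blade_coeff (zeon_const c * u) I = c * blade_coeff u I"
proof (cases "finite I")
  case True
  have "(\<Sum>J\<in>Pow I. (if J = {} then c else 0) * blade_coeff u (I - J)) =
      (\<Sum>J\<in>Pow I. if J = {} then c * blade_coeff u I else 0)"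
    by (rule sum.cong) auto
  then show ?thesis using True by (simp add: times_zeon.rep_eq zeon_const.rep_eq)
next
  case False
  then show ?thesis by (simp add: blade_coeff_infinite)
qed

lemma zeon_const_hom:
  "zeon_const 0 = 0" "zeon_const 1 = 1"
  "zeon_const (c + d) = zeon_const c + zeon_const d"
  "zeon_const (c * d) = zeon_const c * zeon_const d"
  by (rule zeon_eqI; simp add: zeon_const.rep_eq zero_zeon.rep_eq one_zeon.rep_eq
      plus_zeon.rep_eq blade_coeff_const_mult)+

lemma zeon_gen_square: "zeon_gen i * zeon_gen i = 0"
proof (rule zeon_eqI)
  fix I :: "nat set"
  have "(\<Sum>J\<in>Pow I. (if J = {i} then 1 else 0) * (if I - J = {i} then 1 else 0)) = (0 :: complex)"
    by (rule sum.neutral) auto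
  then show "blade_coeff (zeon_gen i * zeon_gen i) I = blade_coeff 0 I"
    by (simp add: times_zeon.rep_eq zeon_gen.rep_eq zero_zeon.rep_eq)
qed

lemma blade_coeff_blade:
  assumes "finite I"
  shows "blade_coeff (\<Prod>i\<in>I. zeon_gen i) K = (if K = I then 1 else 0)"
  using assms
proof (induction I arbitrary: K rule: finite_induct)
  case empty
  then show ?case by (simp add: one_zeon.rep_eq)
next
  case (insert i I)
  show ?case
  proof (cases "finite K")
    case True
    have "blade_coeff (\<Prod>i\<in>insert i I. zeon_gen i) K =
        (\<Sum>J\<in>Pow K. (if J = {i} then 1 else 0) * (if K - J = I then 1 else 0))"
      using insert by (simp add: times_zeon.rep_eq zeon_gen.rep_eq)
    also have "\<dots> = (\<Sum>J\<in>Pow K. if J = {i} then (if K - {i} = I then 1 else 0) else 0)"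
      by (rule sum.cong) auto
    also have "\<dots> = (if i \<in> K \<and> K - {i} = I then 1 else 0)"
      using True by (simp add: sum.delta)
    also have "(i \<in> K \<and> K - {i} = I) = (K = insert i I)" using insert by auto
    finally show ?thesis .
  next
    case False
    then have "K \<noteq> insert i I" using insert.hyps(1) by auto
    with False show ?thesis by (simp add: blade_coeff_infinite)
  qed
qed

lemma blade_coeff_sum: "blade_coeff (sum f S) I = (\<Sum>x\<in>S. blade_coeff (f x) I)"
  by (induction S rule: infinite_finite_induct) (auto simp: zero_zeon.rep_eq plus_zeon.rep_eq)

lemma zeon_expansion:
  "u = (\<Sum>I | blade_coeff u I \<noteq> 0. zeon_const (blade_coeff u I) * (\<Prod>i\<in>I. zeon_gen i))"
proof (rule zeon_eqI)
  fix K :: "nat set"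
  have fin: "finite I" if "blade_coeff u I \<noteq> 0" for I
    using that blade_coeff_infinite by blast
  have "(\<Sum>I | blade_coeff u I \<noteq> 0. blade_coeff u I * blade_coeff (\<Prod>i\<in>I. zeon_gen i) K) =
      (\<Sum>I | blade_coeff u I \<noteq> 0. if K = I then blade_coeff u I else 0)"
    by (rule sum.cong) (auto simp: blade_coeff_blade fin)
  also have "\<dots> = blade_coeff u K" using finite_support[of u] by simp
  finally show "blade_coeff u K = blade_coeff
      (\<Sum>I | blade_coeff u I \<noteq> 0. zeon_const (blade_coeff u I) * (\<Prod>i\<in>I. zeon_gen i)) K"
    by (simp add: blade_coeff_sum blade_coeff_const_mult)
qed

section \<open>Vectors and matrices over the zeon algebra\<close>

text \<open>
  The library's \<open>mat_adjoint\<close> requires entries from a field, hence the following version for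
  arbitrary rings with conjugation.
\<close>

definition conj_transpose :: "'a :: conjugatable_ring mat \<Rightarrow> 'a mat" where
  "conj_transpose M = map_mat conjugate (transpose_mat M)"

definition col_mat :: "'a vec \<Rightarrow> 'a mat" where
  "col_mat v = mat_of_cols (dim_vec v) [v]"

text \<open>
  The inner product \<open>\<langle>x, y\<rangle> = y\<^sup>\<dagger> x\<close> is the library's \<open>x \<bullet>c y = (\<Sum>i. x\<^sub>i * conjugate y\<^sub>i)\<close>.
\<close>

lemma inner_eq_conj_transpose_mult:
  fixes x y :: "zeon vec"
  assumes "dim_vec x = dim_vec y"
  shows "x \<bullet>c y = (conj_transpose (col_mat y) * col_mat x) $$ (0, 0)"
  using assms
  by (simp add: conj_transpose_def col_mat_def scalar_prod_def mat_of_cols_def mult.commute)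

definition null_vec :: "zeon vec \<Rightarrow> bool" where
  "null_vec v \<longleftrightarrow> scalar_part (v \<bullet>c v) = 0"

definition normalized_vec :: "zeon vec \<Rightarrow> bool" where
  "normalized_vec v \<longleftrightarrow> \<not> null_vec v \<and> v \<bullet>c v = 1"

definition self_adjoint_mat :: "zeon mat \<Rightarrow> bool" where
  "self_adjoint_mat A \<longleftrightarrow> conj_transpose A = A"

section \<open>Spectrally simple zeros and zeon eigenvalues\<close>

definition induced_poly :: "zeon poly \<Rightarrow> complex poly" where
  "induced_poly \<phi> = map_poly scalar_part \<phi>"

text \<open>
  The conjunct \<open>induced_poly \<phi> \<noteq> 0\<close> is needed because \<^const>\<open>Polynomial.order\<close> is unspecified at the zero
  polynomial.
\<close>

definition spectrally_simple_zero :: "zeon poly \<Rightarrow> zeon \<Rightarrow> bool" where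
  "spectrally_simple_zero \<phi> l \<longleftrightarrow>
     poly \<phi> l = 0 \<and> induced_poly \<phi> \<noteq> 0 \<and> Polynomial.order (scalar_part l) (induced_poly \<phi>) = 1"

definition zeon_eigenvalue :: "zeon mat \<Rightarrow> zeon \<Rightarrow> bool" where
  "zeon_eigenvalue A l \<longleftrightarrow> spectrally_simple_zero (char_poly A) l"

definition zeon_eigenvector :: "zeon mat \<Rightarrow> zeon vec \<Rightarrow> zeon \<Rightarrow> bool" where
  "zeon_eigenvector A \<xi> l \<longleftrightarrow>
     zeon_eigenvalue A l \<and> \<xi> \<in> carrier_vec (dim_row A) \<and> \<not> null_vec \<xi> \<and> A *\<^sub>v \<xi> = l \<cdot>\<^sub>v \<xi>"

end

theory Submission
  imports Defs
begin

text \<open>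
  The zeon algebra has zero divisors, but an element with nonzero scalar part is never one.  This is
  what makes the classical proof of the spectral theorem go through.  Two spectrally simple zeros
  with the same scalar part coincide (\<open>spectrally_simple_zeros_eqI\<close>), so the \<open>m\<close> distinct eigenvalues
  have distinct scalar parts and their differences can be cancelled
  (\<open>nonzero_scalar_part_cancel\<close>).

  Moving \<open>A\<close> from one side of the inner product to the other
  (\<open>self_adjoint_eigenvalue_exchange\<close>) first shows that every eigenvalue equals its own conjugate,
  because \<open>\<langle>v\<^sub>j, v\<^sub>j\<rangle> = 1\<close>, and then gives \<open>(\<lambda>\<^sub>i - \<lambda>\<^sub>j) \<langle>v\<^sub>i, v\<^sub>j\<rangle> = 0\<close>, that is,
  \<open>\<langle>v\<^sub>i, v\<^sub>j\<rangle> = 0\<close> for \<open>i \<noteq> j\<close>.  Hence the matrix \<open>V\<close> with columns \<open>v\<^sub>1, \<dots>, v\<^sub>m\<close> satisfies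
  \<open>V\<^sup>\<dagger> V = 1\<close>.  Over a commutative ring a left inverse of a square matrix is also a right inverse
  (\<open>mat_left_inverse_imp_right_inverse\<close>), so \<open>A = A V V\<^sup>\<dagger>\<close>.  As column \<open>j\<close> of \<open>A V\<close> is
  \<open>\<lambda>\<^sub>j v\<^sub>j\<close>, this product is the sum of the matrices \<open>\<lambda>\<^sub>j v\<^sub>j v\<^sub>j\<^sup>\<dagger>\<close>.
\<close>

lemma comm_ring_hom_scalar_part: "comm_ring_hom scalar_part"
  by unfold_locales
    (simp_all add: scalar_part_def zero_zeon.rep_eq one_zeon.rep_eq plus_zeon.rep_eq
      times_zeon.rep_eq)

lemma scalar_part_diff: "scalar_part (x - y) = scalar_part x - scalar_part y"
proof -
  interpret comm_ring_hom scalar_part by (rule comm_ring_hom_scalar_part)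
  show ?thesis by (rule hom_minus)
qed

text \<open>
  Once the coefficients of \<open>y\<close> vanish on all proper subsets of \<open>I\<close>, only one term of the
  convolution for \<open>\<zeta>\<^sub>I\<close> in \<open>x y\<close> survives: the scalar part of \<open>x\<close> times \<open>y\<^sub>I\<close>.  So \<open>y\<^sub>I = 0\<close> follows by
  induction on \<open>I\<close>.
\<close>

lemma nonzero_scalar_part_cancel:
  assumes x: "scalar_part x \<noteq> 0" and xy: "x * y = 0"
  shows "y = 0"
proof (rule zeon_eqI)
  fix I :: "nat set" assume "finite I"
  then show "blade_coeff y I = blade_coeff 0 I"
  proof (induction I rule: finite_psubset_induct)
    case (psubset I)
    have "(\<Sum>J\<in>Pow I. blade_coeff x J * blade_coeff y (I - J)) =
        (\<Sum>J\<in>Pow I. if J = {} then blade_coeff x {} * blade_coeff y I else 0)"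
    proof (rule sum.cong[OF refl])
      fix J assume J: "J \<in> Pow I"
      show "blade_coeff x J * blade_coeff y (I - J) =
          (if J = {} then blade_coeff x {} * blade_coeff y I else 0)"
      proof (cases "J = {}")
        case False
        with J have "I - J \<subset> I" by blast
        then show ?thesis using False psubset.IH by (simp add: zero_zeon.rep_eq)
      qed simp
    qed
    also have "\<dots> = scalar_part x * blade_coeff y I"
      using psubset.hyps by (simp add: scalar_part_def)
    also have "(\<Sum>J\<in>Pow I. blade_coeff x J * blade_coeff y (I - J)) = 0"
      using arg_cong[OF xy, of "\<lambda>u. blade_coeff u I"]
      by (simp add: times_zeon.rep_eq zero_zeon.rep_eq)
    finally show ?case using x by (simp add: zero_zeon.rep_eq)
  qed
qed

text \<open>
  Write \<open>p(t) = (t - a) q(t)\<close>.  Simplicity says that the scalar part of \<open>q(b)\<close>, which depends only on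
  the scalar part of \<open>b\<close>, is nonzero.  Hence \<open>q(b)\<close> can be cancelled from \<open>0 = p(b) = (b - a) q(b)\<close>.
\<close>

lemma spectrally_simple_zeros_eqI:
  assumes a: "spectrally_simple_zero p a" and b: "poly p b = 0"
    and ab: "scalar_part a = scalar_part b"
  shows "a = b"
proof -
  interpret s: comm_ring_hom scalar_part by (rule comm_ring_hom_scalar_part)
  interpret ps: map_poly_comm_ring_hom scalar_part ..
  from a have "poly p a = 0" and p0: "induced_poly p \<noteq> 0"
    and ord: "Polynomial.order (scalar_part a) (induced_poly p) = 1"
    by (simp_all add: spectrally_simple_zero_def)
  then obtain q where q: "p = [:- a, 1:] * q"
    by (auto simp: poly_eq_0_iff_dvd)
  have fac: "induced_poly p = [:- scalar_part a, 1:] * induced_poly q"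
    unfolding q induced_poly_def ps.hom_mult by (simp add: s.hom_uminus)
  have "Polynomial.order (scalar_part a) (induced_poly p) =
      1 + Polynomial.order (scalar_part a) (induced_poly q)"
    using p0 order_power_n_n[of "scalar_part a" 1] unfolding fac
    by (subst order_mult) simp_all
  with ord p0 fac have "poly (induced_poly q) (scalar_part a) \<noteq> 0"
    by (auto simp: order_root)
  then have nz: "scalar_part (poly q b) \<noteq> 0"
    unfolding ab induced_poly_def by simp
  have "poly q b * (b - a) = 0"
    using b unfolding q by (simp add: algebra_simps)
  from nonzero_scalar_part_cancel[OF nz this] show ?thesis by simp
qed

lemma cscalar_prod_conj_transpose:
  fixes A :: "'a :: {conjugatable_ring, comm_ring} mat"
  assumes A: "A \<in> carrier_mat n m" and x: "x \<in> carrier_vec m" and y: "y \<in> carrier_vec n"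
  shows "(A *\<^sub>v x) \<bullet>c y = x \<bullet>c (conj_transpose A *\<^sub>v y)"
proof -
  have "(A *\<^sub>v x) \<bullet>c y = (\<Sum>i<n. \<Sum>k<m. A $$ (i, k) * x $ k * conjugate (y $ i))"
    using assms by (simp add: scalar_prod_def sum_distrib_right lessThan_atLeast0)
  also have "\<dots> = (\<Sum>k<m. \<Sum>i<n. A $$ (i, k) * x $ k * conjugate (y $ i))"
    by (rule sum.swap)
  also have "\<dots> = x \<bullet>c (conj_transpose A *\<^sub>v y)"
    using assms
    by (simp add: scalar_prod_def conj_transpose_def sum_distrib_left sum_conjugate
        conjugate_dist_mul lessThan_atLeast0 ac_simps)
  finally show ?thesis .
qed

text \<open>
  The case \<open>x = y\<close> yields self-conjugate eigenvalues; for different eigenvalues this yields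
  orthogonality.
\<close>

lemma self_adjoint_eigenvalue_exchange:
  assumes A: "A \<in> carrier_mat n n" and sa: "self_adjoint_mat A"
    and x: "x \<in> carrier_vec n" "A *\<^sub>v x = a \<cdot>\<^sub>v x"
    and y: "y \<in> carrier_vec n" "A *\<^sub>v y = b \<cdot>\<^sub>v y"
  shows "a * (x \<bullet>c y) = conjugate b * (x \<bullet>c y)"
proof -
  have "(a \<cdot>\<^sub>v x) \<bullet>c y = x \<bullet>c (b \<cdot>\<^sub>v y)"
    using cscalar_prod_conj_transpose[OF A x(1) y(1)] sa x y by (simp add: self_adjoint_mat_def)
  then show ?thesis using x y by (simp add: conjugate_smult_vec)
qed

text \<open>
  Rank arguments do not apply over a ring, but \<open>B V = 1\<close> makes the determinant of \<open>V\<close> a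
  unit with inverse \<open>det B\<close>, and then \<open>B\<close> must be the adjugate of \<open>V\<close> divided by \<open>det V\<close>, which is a
  two-sided inverse.
\<close>

lemma mat_left_inverse_imp_right_inverse:
  fixes B V :: "'a :: comm_ring_1 mat"
  assumes B: "B \<in> carrier_mat n n" and V: "V \<in> carrier_mat n n" and BV: "B * V = 1\<^sub>m n"
  shows "V * B = 1\<^sub>m n"
proof -
  let ?d = "det V"
  note adj = adj_mat[OF V]
  have d: "det B * ?d = 1" using det_mult[OF B V] BV by simp
  have "adj_mat V = (B * V) * adj_mat V" using BV adj(1) by simp
  also have "\<dots> = B * (V * adj_mat V)" by (rule assoc_mult_mat[OF B V adj(1)])
  also have "\<dots> = ?d \<cdot>\<^sub>m B"
    using B adj(2) mult_smult_distrib[OF B one_carrier_mat, of ?d] by simp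
  finally have "?d \<cdot>\<^sub>m (V * B) = ?d \<cdot>\<^sub>m 1\<^sub>m n"
    using adj(2) mult_smult_distrib[OF V B, of ?d] by simp
  moreover have smult_smult: "a \<cdot>\<^sub>m (b \<cdot>\<^sub>m M) = (a * b) \<cdot>\<^sub>m M" for a b and M :: "'a mat"
    by (rule eq_matI) (auto simp: mult.assoc)
  ultimately have "det B \<cdot>\<^sub>m (?d \<cdot>\<^sub>m (V * B)) = det B \<cdot>\<^sub>m (?d \<cdot>\<^sub>m 1\<^sub>m n)" by simp
  then have "(det B * ?d) \<cdot>\<^sub>m (V * B) = (det B * ?d) \<cdot>\<^sub>m 1\<^sub>m n"
    by (simp add: smult_smult)
  moreover have "1 \<cdot>\<^sub>m M = M" for M :: "'a mat"
    by (rule eq_matI) auto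
  ultimately show ?thesis using d by simp
qed

lemma finsum_mat:
  fixes f :: "'b \<Rightarrow> 'a :: comm_ring_1 mat"
  assumes "finite S" and "\<And>x. x \<in> S \<Longrightarrow> f x \<in> carrier_mat n n"
  shows "(\<Oplus>\<^bsub>ring_mat TYPE('a) n b\<^esub> x \<in> S. f x) = mat n n (\<lambda>(i, j). \<Sum>x\<in>S. f x $$ (i, j))"
proof -
  interpret ring "ring_mat TYPE('a) n b" by (rule ring_mat)
  show ?thesis
    using assms
  proof (induction S rule: finite_induct)
    case empty
    show ?case unfolding finsum_empty by (auto simp: ring_mat_simps)
  next
    case (insert x S)
    then have "f \<in> S \<rightarrow> carrier (ring_mat TYPE('a) n b)" "f x \<in> carrier (ring_mat TYPE('a) n b)"
      by (auto simp: ring_mat_def)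
    with insert have "(\<Oplus>\<^bsub>ring_mat TYPE('a) n b\<^esub> x \<in> insert x S. f x) =
        f x + mat n n (\<lambda>(i, j). \<Sum>x\<in>S. f x $$ (i, j))"
      by (simp add: finsum_insert ring_mat_simps split_def)
    then show ?case using insert by auto
  qed
qed

theorem theorem6p7:
  fixes m :: nat and A :: "zeon mat" and l :: "nat \<Rightarrow> zeon"
    and v :: "nat \<Rightarrow> zeon vec" and \<pi> :: "nat \<Rightarrow> zeon mat"
  assumes "m > 0"
    and "A \<in> carrier_mat m m"
    and "self_adjoint_mat A"
    and "inj_on l {1..m}"
    and "\<And>j. j \<in> {1..m} \<Longrightarrow> zeon_eigenvalue A (l j)"
    and "\<And>j. j \<in> {1..m} \<Longrightarrow> zeon_eigenvector A (v j) (l j)"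
    and "\<And>j. j \<in> {1..m} \<Longrightarrow> normalized_vec (v j)"
    and "\<And>j. j \<in> {1..m} \<Longrightarrow> \<pi> j = col_mat (v j) * conj_transpose (col_mat (v j))"
  shows "A = (\<Oplus>\<^bsub>ring_mat TYPE(zeon) m ()\<^esub> j \<in> {1..m}. l j \<cdot>\<^sub>m \<pi> j)"
proof -
  note A = assms(2)
  have v: "v j \<in> carrier_vec m" and Av: "A *\<^sub>v v j = l j \<cdot>\<^sub>v v j" if "j \<in> {1..m}" for j
    using assms(6)[OF that] A by (auto simp: zeon_eigenvector_def)
  have norm: "v j \<bullet>c v j = 1" if "j \<in> {1..m}" for j
    using assms(7)[OF that] by (simp add: normalized_vec_def)
  \<comment> \<open>Both sides of the exchange identity for the pair \<open>v j\<close>, \<open>v j\<close> carry the factor \<open>1\<close>.\<close>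
  have real: "conjugate (l j) = l j" if "j \<in> {1..m}" for j
    using self_adjoint_eigenvalue_exchange[OF A assms(3) v Av v Av, OF that that that that]
      norm[OF that] by simp
  have orth: "v i \<bullet>c v j = 0" if i: "i \<in> {1..m}" and j: "j \<in> {1..m}" and "i \<noteq> j" for i j
  proof (rule nonzero_scalar_part_cancel)
    have "l i \<noteq> l j" using assms(4) that by (auto dest: inj_onD)
    then show "scalar_part (l i - l j) \<noteq> 0"
      using assms(5)[OF i] assms(5)[OF j] spectrally_simple_zeros_eqI[of "char_poly A" "l i" "l j"]
      by (auto simp: scalar_part_diff zeon_eigenvalue_def spectrally_simple_zero_def)
    show "(l i - l j) * (v i \<bullet>c v j) = 0"
      using self_adjoint_eigenvalue_exchange[OF A assms(3) v Av v Av, OF i i j j] real[OF j]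
      by (simp add: left_diff_distrib)
  qed
  \<comment> \<open>The matrix indices start at \<open>0\<close>, the eigenvectors at \<open>1\<close>.\<close>
  define V where "V = mat m m (\<lambda>(i, j). v (Suc j) $ i)"
  have V: "V \<in> carrier_mat m m" and W: "conj_transpose V \<in> carrier_mat m m"
    by (auto simp: V_def conj_transpose_def)
  have "conj_transpose V * V = 1\<^sub>m m"
  proof (rule eq_matI)
    fix i j assume "i < dim_row (1\<^sub>m m :: zeon mat)" "j < dim_col (1\<^sub>m m :: zeon mat)"
    then have ij: "i < m" "j < m" "Suc i \<in> {1..m}" "Suc j \<in> {1..m}" by auto
    then have "(conj_transpose V * V) $$ (i, j) = v (Suc j) \<bullet>c v (Suc i)"
      using v[OF ij(3)] v[OF ij(4)]
      by (simp add: scalar_prod_def V_def conj_transpose_def mult.commute)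
    then show "(conj_transpose V * V) $$ (i, j) = 1\<^sub>m m $$ (i, j)"
      using ij norm[OF ij(4)] orth[OF ij(4,3)] by auto
  qed (auto simp: V_def conj_transpose_def)
  then have "V * conj_transpose V = 1\<^sub>m m"
    by (rule mat_left_inverse_imp_right_inverse[OF W V])
  then have AVW: "A = (A * V) * conj_transpose V"
    using assoc_mult_mat[OF A V W] A by simp
  have AV: "A * V = mat m m (\<lambda>(i, j). l (Suc j) * v (Suc j) $ i)"
  proof (rule eq_matI)
    fix i j assume "i < dim_row (mat m m (\<lambda>(i, j). l (Suc j) * v (Suc j) $ i))"
      "j < dim_col (mat m m (\<lambda>(i, j). l (Suc j) * v (Suc j) $ i))"
    then have ij: "i < m" "j < m" "Suc j \<in> {1..m}" by auto
    have "col V j = v (Suc j)" using v[OF ij(3)] ij by (auto simp: V_def)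
    then have "(A * V) $$ (i, j) = (A *\<^sub>v v (Suc j)) $ i" using A V ij by simp
    then show "(A * V) $$ (i, j) = mat m m (\<lambda>(i, j). l (Suc j) * v (Suc j) $ i) $$ (i, j)"
      using Av[OF ij(3)] v[OF ij(3)] ij by simp
  qed (use A V in auto)
  have pi_entry: "\<pi> j $$ (i, k) = v j $ i * conjugate (v j $ k)"
    if "j \<in> {1..m}" "i < m" "k < m" for i j k
    using assms(8)[OF that(1)] v[OF that(1)] that(2,3)
    by (simp add: col_mat_def conj_transpose_def scalar_prod_def mat_of_cols_def)
  have pi: "l j \<cdot>\<^sub>m \<pi> j \<in> carrier_mat m m" if "j \<in> {1..m}" for j
    using assms(8)[OF that] v[OF that] by (auto simp: col_mat_def conj_transpose_def)
  have "A = mat m m (\<lambda>(i, k). \<Sum>j\<in>{1..m}. (l j \<cdot>\<^sub>m \<pi> j) $$ (i, k))"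
  proof (rule eq_matI)
    fix i k assume "i < dim_row (mat m m (\<lambda>(i, k). \<Sum>j\<in>{1..m}. (l j \<cdot>\<^sub>m \<pi> j) $$ (i, k)))"
      "k < dim_col (mat m m (\<lambda>(i, k). \<Sum>j\<in>{1..m}. (l j \<cdot>\<^sub>m \<pi> j) $$ (i, k)))"
    then have ik: "i < m" "k < m" by auto
    have "A $$ (i, k) = (\<Sum>j<m. l (Suc j) * v (Suc j) $ i * conjugate (v (Suc j) $ k))"
      using ik by (subst AVW, unfold AV)
        (simp add: scalar_prod_def V_def conj_transpose_def lessThan_atLeast0)
    also have "\<dots> = (\<Sum>j\<in>{1..m}. l j * v j $ i * conjugate (v j $ k))"
      using sum.atLeast1_atMost_eq[of "\<lambda>j. l j * v j $ i * conjugate (v j $ k)" m] by simp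
    also have "\<dots> = (\<Sum>j\<in>{1..m}. (l j \<cdot>\<^sub>m \<pi> j) $$ (i, k))"
    proof (rule sum.cong[OF refl])
      fix j assume j: "j \<in> {1..m}"
      show "l j * v j $ i * conjugate (v j $ k) = (l j \<cdot>\<^sub>m \<pi> j) $$ (i, k)"
        using carrier_matD[OF pi[OF j]] pi_entry[OF j ik] ik by (simp add: mult.assoc)
    qed
    finally show "A $$ (i, k) = mat m m (\<lambda>(i, k). \<Sum>j\<in>{1..m}. (l j \<cdot>\<^sub>m \<pi> j) $$ (i, k)) $$ (i, k)"
      using ik by simp
  qed (use A in auto)
  also have "\<dots> = (\<Oplus>\<^bsub>ring_mat TYPE(zeon) m ()\<^esub> j \<in> {1..m}. l j \<cdot>\<^sub>m \<pi> j)"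
    by (rule finsum_mat[symmetric]) (use pi in auto)
  finally show ?thesis .
qed

end
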